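(* If $v$ is prime, $k>1$ and $m>2$, then there does not exist a $(v,m,k,\lambda)$-SEDF.
   Context: Let $v,m,k,\lambda$ be positive integers with $k^2(m-1)=\lambda(v-1)$. A $(v,m,k,\lambda)$-SEDF (strong external difference family) is a collection $(D_1,\ldots,D_m)$ of pairwise disjoint subsets of some finite abelian group $G$ (written multiplicatively, with identity $1$) with $|G|=v$ and $|D_j|=k$ for all $1\le j\le m$, such that for each $1\le j\le m$ the equation $\sum_{\ell\ne j} D_j D_\ell^{-1}=\lambda(G-1)$ holds in the group algebra $\mathbb{C}[G]$. Here a subset $S\subseteq G$ is identified with the group algebra element $\sum_{g\in S} g$, and $S^{-1}$ denotes $\sum_{g\in S} g^{-1}$. *)

theory Defs
  imports
    Complex_Main
    "HOL-Algebra.Algebra"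
    "HOL-Library.Disjoint_Sets"
    "HOL-Library.Indicator_Function"
    "HOL-Computational_Algebra.Primes"
begin

text \<open>
  The group algebra \<open>\<complex>[G]\<close> of a finite group \<open>G\<close>: an element \<open>\<Sum>g. f g \<cdot> g\<close> is represented by its
  coefficient function \<open>f\<close>, which vanishes outside \<open>carrier G\<close>. There is no finite-support condition,
  and an infinite index set would make the sum in the product collapse to \<open>0\<close>, so the definition is
  only meaningful for finite \<open>carrier G\<close>.
\<close>

definition group_algebra :: "('a, 'b) monoid_scheme \<Rightarrow> (complex, 'a \<Rightarrow> complex) module" where
  "group_algebra G =
    \<lparr> carrier = {f. \<forall>x. x \<notin> carrier G \<longrightarrow> f x = 0},
      monoid.mult = (\<lambda>f h x. \<Sum>(y, z) \<in> {(y, z) \<in> carrier G \<times> carrier G. y \<otimes>\<^bsub>G\<^esub> z = x}. f y * h z),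
      one = indicator {\<one>\<^bsub>G\<^esub>},
      ring.zero = (\<lambda>_. 0),
      add = (\<lambda>f h x. f x + h x),
      smult = (\<lambda>c f x. c * f x) \<rparr>"

definition subset_sum :: "('a, 'b) monoid_scheme \<Rightarrow> 'a set \<Rightarrow> 'a \<Rightarrow> complex" where
  "subset_sum G S = (\<Oplus>\<^bsub>group_algebra G\<^esub> g \<in> S. indicator {g})"

definition subset_inv_sum :: "('a, 'b) monoid_scheme \<Rightarrow> 'a set \<Rightarrow> 'a \<Rightarrow> complex" where
  "subset_inv_sum G S = (\<Oplus>\<^bsub>group_algebra G\<^esub> g \<in> S. indicator {inv\<^bsub>G\<^esub> g})"

text \<open>
  The side conditions on the parameters (positivity and \<open>k\<^sup>2 (m - 1) = lam (v - 1)\<close>) are not part of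
  this predicate.
\<close>

definition SEDF ::
  "nat \<Rightarrow> nat \<Rightarrow> nat \<Rightarrow> nat \<Rightarrow> ('a, 'b) monoid_scheme \<Rightarrow> (nat \<Rightarrow> 'a set) \<Rightarrow> bool" where
  "SEDF v m k lam G D \<longleftrightarrow>
     comm_group G \<and> finite (carrier G) \<and> order G = v \<and>
     (\<forall>j\<in>{1..m}. D j \<subseteq> carrier G \<and> card (D j) = k) \<and>
     disjoint_family_on D {1..m} \<and>
     (\<forall>j\<in>{1..m}.
        (\<Oplus>\<^bsub>group_algebra G\<^esub> l \<in> {1..m} - {j}.
           subset_sum G (D j) \<otimes>\<^bsub>group_algebra G\<^esub> subset_inv_sum G (D l)) =
        of_nat lam \<odot>\<^bsub>group_algebra G\<^esub>
          (subset_sum G (carrier G) \<ominus>\<^bsub>group_algebra G\<^esub> \<one>\<^bsub>group_algebra G\<^esub>))"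

lemma group_algebra_mult_eq:
  fixes G (structure)
  assumes "group G" "finite (carrier G)" "x \<in> carrier G"
  shows "(f \<otimes>\<^bsub>group_algebra G\<^esub> h) x = (\<Sum>y\<in>carrier G. f y * h (inv\<^bsub>G\<^esub> y \<otimes>\<^bsub>G\<^esub> x))"
proof -
  interpret group G by fact
  show ?thesis
    unfolding group_algebra_def using assms(3)
    by (simp, intro sum.reindex_bij_witness[where i="\<lambda>y. (y, inv y \<otimes> x)" and j=fst])
       (auto simp: m_assoc[symmetric])
qed

lemma cring_group_algebra:
  fixes G (structure)
  assumes "comm_group G" "finite (carrier G)"
  shows "cring (group_algebra G)"
proof -
  interpret comm_group G by fact
  note fin = assms(2)
  let ?A = "group_algebra G"
  note me = group_algebra_mult_eq[OF is_group fin]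
  have out: "(f \<otimes>\<^bsub>?A\<^esub> h) x = 0" if "x \<notin> carrier G" for f h x
    using that unfolding group_algebra_def by (auto intro!: sum.neutral)
  have comm: "f \<otimes>\<^bsub>?A\<^esub> h = h \<otimes>\<^bsub>?A\<^esub> f" for f h
  proof (rule ext)
    fix x
    show "(f \<otimes>\<^bsub>?A\<^esub> h) x = (h \<otimes>\<^bsub>?A\<^esub> f) x"
      unfolding group_algebra_def
      by (simp, intro sum.reindex_bij_witness[where i=prod.swap and j=prod.swap])
         (auto simp: m_comm)
  qed
  have assoc: "(f \<otimes>\<^bsub>?A\<^esub> g) \<otimes>\<^bsub>?A\<^esub> h = f \<otimes>\<^bsub>?A\<^esub> (g \<otimes>\<^bsub>?A\<^esub> h)" for f g h
  proof (rule ext)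
    fix x
    show "((f \<otimes>\<^bsub>?A\<^esub> g) \<otimes>\<^bsub>?A\<^esub> h) x = (f \<otimes>\<^bsub>?A\<^esub> (g \<otimes>\<^bsub>?A\<^esub> h)) x"
    proof (cases "x \<in> carrier G")
      case True
      have "((f \<otimes>\<^bsub>?A\<^esub> g) \<otimes>\<^bsub>?A\<^esub> h) x =
        (\<Sum>y\<in>carrier G. \<Sum>z\<in>carrier G. f z * g (inv z \<otimes> y) * h (inv y \<otimes> x))"
        using True by (simp add: me sum_distrib_right)
      also have "\<dots> = (\<Sum>z\<in>carrier G. \<Sum>y\<in>carrier G. f z * g (inv z \<otimes> y) * h (inv y \<otimes> x))"
        by (rule sum.swap)
      also have "\<dots> = (\<Sum>z\<in>carrier G. \<Sum>w\<in>carrier G. f z * g w * h (inv w \<otimes> (inv z \<otimes> x)))"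
      proof (rule sum.cong[OF refl])
        fix z assume z: "z \<in> carrier G"
        have cancel: "inv (inv z \<otimes> y) \<otimes> inv z = inv y" if "y \<in> carrier G" for y
          using z that by (simp add: inv_mult_group m_assoc)
        show "(\<Sum>y\<in>carrier G. f z * g (inv z \<otimes> y) * h (inv y \<otimes> x)) =
              (\<Sum>w\<in>carrier G. f z * g w * h (inv w \<otimes> (inv z \<otimes> x)))"
          by (rule sum.reindex_bij_witness[where i="\<lambda>w. z \<otimes> w" and j="\<lambda>y. inv z \<otimes> y"])
             (use z True cancel in \<open>auto simp: m_assoc[symmetric]\<close>)
      qed
      also have "\<dots> = (f \<otimes>\<^bsub>?A\<^esub> (g \<otimes>\<^bsub>?A\<^esub> h)) x"
        using True by (simp add: me sum_distrib_left mult.assoc)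
      finally show ?thesis .
    qed (simp add: out)
  qed
  have one: "\<one>\<^bsub>?A\<^esub> \<otimes>\<^bsub>?A\<^esub> f = f" if "f \<in> carrier ?A" for f
  proof (rule ext)
    fix x
    show "(\<one>\<^bsub>?A\<^esub> \<otimes>\<^bsub>?A\<^esub> f) x = f x"
    proof (cases "x \<in> carrier G")
      case True
      have "(\<one>\<^bsub>?A\<^esub> \<otimes>\<^bsub>?A\<^esub> f) x = (\<Sum>y\<in>carrier G. if y = \<one> then f x else 0)"
        unfolding me[OF True] using True
        by (auto simp: group_algebra_def indicator_def intro!: sum.cong)
      then show ?thesis using fin by simp
    next
      case False
      then show ?thesis using that by (simp add: out) (simp add: group_algebra_def)
    qed
  qed
  have abel: "abelian_group ?A"
  proof (rule abelian_groupI)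
    fix f assume "f \<in> carrier ?A"
    then show "\<exists>h\<in>carrier ?A. h \<oplus>\<^bsub>?A\<^esub> f = \<zero>\<^bsub>?A\<^esub>"
      by (intro bexI[where x="\<lambda>x. - f x"]) (auto simp: group_algebra_def)
  qed (simp_all add: group_algebra_def add_ac)
  show ?thesis
  proof (rule cringI[OF abel])
    show "comm_monoid ?A"
    proof (rule comm_monoidI)
      show "\<And>f h. f \<in> carrier ?A \<Longrightarrow> h \<in> carrier ?A \<Longrightarrow> f \<otimes>\<^bsub>?A\<^esub> h \<in> carrier ?A"
        using out by (simp add: group_algebra_def)
      show "\<one>\<^bsub>?A\<^esub> \<in> carrier ?A"
        by (auto simp: group_algebra_def indicator_def)
    qed (rule assoc, rule one, assumption, rule comm)
    show "(f \<oplus>\<^bsub>?A\<^esub> g) \<otimes>\<^bsub>?A\<^esub> h = f \<otimes>\<^bsub>?A\<^esub> h \<oplus>\<^bsub>?A\<^esub> g \<otimes>\<^bsub>?A\<^esub> h" for f g h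
      by (simp add: group_algebra_def sum.distrib distrib_right case_prod_beta)
  qed
qed

lemma group_algebra_mult_indicator:
  fixes G (structure)
  assumes "group G" "finite (carrier G)" "g \<in> carrier G" "h \<in> carrier G"
  shows "indicator {g} \<otimes>\<^bsub>group_algebra G\<^esub> indicator {h} = indicator {g \<otimes>\<^bsub>G\<^esub> h}"
proof (rule ext)
  interpret group G by fact
  let ?A = "group_algebra G"
  fix x
  show "(indicator {g} \<otimes>\<^bsub>?A\<^esub> indicator {h}) x = indicator {g \<otimes> h} x"
  proof (cases "x \<in> carrier G")
    case True
    have "(indicator {g} \<otimes>\<^bsub>?A\<^esub> indicator {h}) x =
      (\<Sum>y\<in>carrier G. if y = g then indicator {h} (inv g \<otimes> x) else 0)"
      unfolding group_algebra_mult_eq[OF assms(1,2) True]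
      by (auto simp: indicator_def intro!: sum.cong)
    also have "\<dots> = indicator {h} (inv g \<otimes> x)"
      using assms by simp
    also have "\<dots> = indicator {g \<otimes> h} x"
    proof -
      have "inv g \<otimes> x = h \<longleftrightarrow> x = g \<otimes> h"
        using True assms by (auto simp: m_assoc[symmetric])
      then show ?thesis by (simp add: indicator_def)
    qed
    finally show ?thesis .
  next
    case False
    then show ?thesis using assms
      by (auto simp: group_algebra_def indicator_def intro!: sum.neutral)
  qed
qed

lemma finsum_group_algebra:
  fixes G (structure)
  assumes "comm_group G" "finite (carrier G)" "finite I" "\<And>i. i \<in> I \<Longrightarrow> f i \<in> carrier (group_algebra G)"
  shows "(\<Oplus>\<^bsub>group_algebra G\<^esub> i \<in> I. f i) = (\<lambda>x. \<Sum>i\<in>I. f i x)"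
proof -
  interpret A: cring "group_algebra G"
    using assms(1,2) by (rule cring_group_algebra)
  show ?thesis using assms(3,4)
  proof (induction I rule: finite_induct)
    case empty
    show ?case unfolding A.finsum_empty by (simp add: group_algebra_def)
  next
    case (insert i I)
    then have "f \<in> I \<rightarrow> carrier (group_algebra G)" "f i \<in> carrier (group_algebra G)"
      by auto
    with insert show ?case
      by (subst A.finsum_insert) (simp_all add: group_algebra_def)
  qed
qed

lemma subset_sum_eq_indicator:
  fixes G (structure)
  assumes "comm_group G" "finite (carrier G)" "S \<subseteq> carrier G"
  shows "subset_sum G S = indicator S"
proof -
  have fin: "finite S" using assms finite_subset by blast
  have "subset_sum G S = (\<lambda>x. \<Sum>g\<in>S. indicator {g} x)"
    unfolding subset_sum_def using assms fin
    by (intro finsum_group_algebra) (auto simp: group_algebra_def indicator_def)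
  also have "\<dots> = indicator S"
    using fin by (auto simp: fun_eq_iff indicator_def)
  finally show ?thesis .
qed

lemma subset_inv_sum_eq_indicator:
  fixes G (structure)
  assumes "comm_group G" "finite (carrier G)" "S \<subseteq> carrier G"
  shows "subset_inv_sum G S = indicator (m_inv G ` S)"
proof -
  interpret comm_group G by fact
  have inj: "inj_on (m_inv G) S"
    by (rule inj_on_inverseI[where g="m_inv G"]) (use assms(3) in auto)
  have fin: "finite S" using assms finite_subset by blast
  have "subset_inv_sum G S = (\<lambda>x. \<Sum>g\<in>S. indicator {inv g} x)"
    unfolding subset_inv_sum_def using assms fin
    by (intro finsum_group_algebra) (auto simp: group_algebra_def indicator_def)
  also have "\<dots> = (\<lambda>x. \<Sum>g\<in>m_inv G ` S. indicator {g} x)"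
    by (simp add: sum.reindex[OF inj])
  also have "\<dots> = indicator (m_inv G ` S)"
  proof (rule ext)
    fix x
    show "(\<Sum>g\<in>m_inv G ` S. indicator {g} x) = (indicator (m_inv G ` S) x :: complex)"
      unfolding indicator_def using finite_imageI[OF fin, of "m_inv G"] by simp
  qed
  finally show ?thesis .
qed

end

theory Submission
  imports Defs "HOL-Computational_Algebra.Polynomial_Factorial"
begin

text \<open>
  Let \<open>\<chi>\<close> be a nontrivial character of \<open>G\<close>, \<open>\<eta> j = \<chi>(D\<^sub>j)\<close> and \<open>s = \<Sum>\<^sub>j \<eta> j\<close>. Applying \<open>\<chi>\<close> to the
  SEDF equation gives \<open>\<eta> j * cnj s = \<bar>\<eta> j\<bar>\<^sup>2 - lam\<close>, so the numbers \<open>\<eta> j * cnj s\<close> are real roots of the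
  single quadratic \<open>r\<^sup>2 = \<bar>s\<bar>\<^sup>2 (r + lam)\<close>. If \<open>s \<noteq> 0\<close>, two of any three \<open>\<eta> j\<close> must therefore coincide.
  For \<open>v\<close> prime, the irreducibility of the \<open>v\<close>-th cyclotomic polynomial shows that an integer
  combination of the values of \<open>\<chi>\<close> vanishes only if its coefficients are constant. Thus
  \<open>\<eta> i = \<eta> j\<close> contradicts disjointness of \<open>D\<^sub>i\<close> and \<open>D\<^sub>j\<close>, while \<open>s = 0\<close> forces the \<open>D\<^sub>j\<close> to partition
  \<open>G\<close>, so that \<open>v = m k\<close> is not prime.
\<close>

section \<open>Eisenstein's criterion\<close>

text \<open>By \<open>p2\<close>, some factor \<open>h\<close> of \<open>f = g * h\<close> has
  constant term prime to \<open>p\<close>. At the least \<open>i\<close> where \<open>p\<close> does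
  not divide the coefficient of \<open>g\<close>, it does not divide that of \<open>f\<close>
  either. So \<open>i\<close> is at least the degree of \<open>f\<close>, which forces
  \<open>h\<close> to be constant, and \<open>monic\<close> makes it a unit.\<close>

lemma eisenstein_irreducible:
  fixes f :: "'a :: idom poly"
  assumes p: "prime_elem p"
    and dvd: "\<And>i. i < Polynomial.degree f \<Longrightarrow> p dvd Polynomial.coeff f i"
    and monic: "lead_coeff f = 1"
    and p2: "\<not> p\<^sup>2 dvd Polynomial.coeff f 0"
    and deg: "Polynomial.degree f > 0"
  shows "Factorial_Ring.irreducible f"
proof (rule Factorial_Ring.irreducibleI)
  show "f \<noteq> 0" using deg by auto
  show "\<not> f dvd 1" using deg by (auto simp: is_unit_poly_iff)
  have unit: "h dvd 1" if f: "f = g * h" and h0: "\<not> p dvd Polynomial.coeff h 0" for g h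
  proof -
    have lead: "lead_coeff g * lead_coeff h = 1"
      using monic f by (simp add: lead_coeff_mult)
    have nz: "g \<noteq> 0" "h \<noteq> 0" using lead by auto
    have degf: "Polynomial.degree f = Polynomial.degree g + Polynomial.degree h"
      using f nz by (simp add: degree_mult_eq)
    \<comment> \<open>Otherwise \<open>p\<close> would divide the product of leading coefficients,
      which is 1.\<close>
    have "\<not> (\<forall>i. p dvd Polynomial.coeff g i)"
    proof
      assume "\<forall>i. p dvd Polynomial.coeff g i"
      then have "p dvd lead_coeff g * lead_coeff h" by simp
      with lead p show False by (auto simp: prime_elem_def)
    qed
    then obtain i where i: "\<not> p dvd Polynomial.coeff g i" "\<And>j. j < i \<Longrightarrow> p dvd Polynomial.coeff g j"
      using exists_least_iff[of "\<lambda>i. \<not> p dvd Polynomial.coeff g i"] by auto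
    have "Polynomial.coeff f i = (\<Sum>j<i. Polynomial.coeff g j * Polynomial.coeff h (i - j))
        + Polynomial.coeff g i * Polynomial.coeff h 0"
      by (simp add: f coeff_mult flip: lessThan_Suc_atMost)
    moreover have "p dvd (\<Sum>j<i. Polynomial.coeff g j * Polynomial.coeff h (i - j))"
      using i(2) by (intro dvd_sum) auto
    moreover have "\<not> p dvd Polynomial.coeff g i * Polynomial.coeff h 0"
      using i(1) h0 p by (simp add: prime_elem_dvd_mult_iff)
    ultimately have "\<not> p dvd Polynomial.coeff f i"
      by (simp add: dvd_add_right_iff)
    then have "Polynomial.degree f \<le> i" using dvd not_le by blast
    moreover have "i \<le> Polynomial.degree g"
      using i(1) by (intro le_degree) auto
    ultimately have "Polynomial.degree h = 0" using degf by simp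
    then obtain c where "h = [:c:]" by (rule degree_eq_zeroE)
    moreover from this have "c dvd 1" using lead by (simp, metis dvd_triv_right)
    ultimately show "h dvd 1" by (auto simp: is_unit_poly_iff)
  qed
  fix g h assume f: "f = g * h"
  have "\<not> (p dvd Polynomial.coeff g 0 \<and> p dvd Polynomial.coeff h 0)"
    using p2 by (auto simp: f coeff_mult power2_eq_square intro: mult_dvd_mono)
  then show "g dvd 1 \<or> h dvd 1"
    using unit[of g h] unit[of h g] f by (auto simp: mult.commute)
qed

section \<open>Integer polynomials at complex points\<close>

abbreviation ipoly :: "int poly \<Rightarrow> complex \<Rightarrow> complex" where
  "ipoly f \<equiv> poly (map_poly of_int f)"

lemma ipoly_add: "ipoly (f + g) w = ipoly f w + ipoly g w"
proof -
  have "map_poly of_int (f + g) = map_poly of_int f + (map_poly of_int g :: complex poly)"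
    by (rule poly_eqI) (simp add: coeff_map_poly)
  then show ?thesis by simp
qed

lemma ipoly_smult: "ipoly (Polynomial.smult a f) w = of_int a * ipoly f w"
  by (simp add: map_poly_smult)

lemma ipoly_mult: "ipoly (f * g) w = ipoly f w * ipoly g w"
  by (induction f) (simp_all add: map_poly_pCons ipoly_add ipoly_smult algebra_simps)

lemma ipoly_pcompose: "ipoly (pcompose f g) w = ipoly f (ipoly g w)"
  by (induction f) (simp_all add: pcompose_pCons map_poly_pCons ipoly_add ipoly_mult)

lemma ipoly_sum_monom:
  "ipoly (\<Sum>i<n. Polynomial.monom (a i) i) w = (\<Sum>i<n. of_int (a i) * w ^ i)"
  by (induction n) (simp_all add: ipoly_add map_poly_monom poly_monom)

text \<open>A nonzero integer polynomial \<open>g\<close> of least degree vanishing at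
  \<open>w\<close> divides a constant multiple of \<open>f\<close>. As \<open>f\<close> is prime in
  the factorial ring of integer polynomials, it divides \<open>g\<close>, so no nonzero polynomial
  vanishing at \<open>w\<close> has smaller degree.\<close>

lemma degree_le_of_common_root:
  fixes f h :: "int poly" and w :: complex
  assumes f: "Factorial_Ring.irreducible f" "ipoly f w = 0"
    and h: "h \<noteq> 0" "ipoly h w = 0"
  shows "Polynomial.degree f \<le> Polynomial.degree h"
proof -
  define P where "P g \<longleftrightarrow> g \<noteq> 0 \<and> ipoly g w = 0" for g :: "int poly"
  define g where "g = arg_min Polynomial.degree P"
  have Ph: "P h" using h by (simp add: P_def)
  have g: "P g" and min: "\<And>q. P q \<Longrightarrow> Polynomial.degree g \<le> Polynomial.degree q"
    unfolding g_def using Ph by (blast intro: arg_min_natI, blast intro: arg_min_nat_le)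
  have prime: "prime_elem f"
    using f(1) by (simp add: prime_elem_iff_irreducible)
  \<comment> \<open>Integer coefficients allow only pseudo-division, hence the factor
    \<open>a\<close>. The remainder also vanishes at \<open>w\<close>, so minimality of
    \<open>g\<close> makes it zero.\<close>
  obtain a q where a: "a \<noteq> 0" and eq: "Polynomial.smult a f = g * q + pseudo_mod f g"
    using pseudo_mod(1)[of g f] g by (auto simp: P_def)
  have "\<not> P (pseudo_mod f g)"
    using pseudo_mod(2)[of g f] g min by (fastforce simp: P_def)
  moreover have "ipoly (pseudo_mod f g) w = 0"
    using arg_cong[OF eq, of "\<lambda>q. ipoly q w"] f(2) g
    by (simp add: P_def ipoly_add ipoly_mult ipoly_smult)
  ultimately have eq: "Polynomial.smult a f = g * q" using eq by (simp add: P_def)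
  then have "f dvd g * q" by (metis dvd_refl dvd_smult)
  then have "f dvd g"
  proof (rule prime_elem_dvd_multD[OF prime, THEN disjE])
    \<comment> \<open>Cancelling \<open>f\<close> would make \<open>g\<close> a divisor of the
      constant \<open>a\<close>, hence a nonzero constant, which has no root.\<close>
    assume "f dvd q"
    then obtain s where s: "q = f * s" by auto
    have "f * [:a:] = f * (g * s)" using eq s by (simp add: mult_ac)
    then have "[:a:] = g * s"
      using prime mult_left_cancel[of f "[:a:]" "g * s"] unfolding prime_elem_def by blast
    then have "Polynomial.degree g = 0"
      using a by (metis degree_mult_eq_0 degree_pCons_0 pCons_eq_0_iff mult_zero_left mult_zero_right)
    then obtain c where "g = [:c:]" by (metis degree_eq_zeroE)
    with g show ?thesis by (simp add: P_def map_poly_pCons)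
  qed
  then have "Polynomial.degree f \<le> Polynomial.degree g"
    using g by (intro dvd_imp_degree_le) (auto simp: P_def)
  also have "\<dots> \<le> Polynomial.degree h" using min[OF Ph] .
  finally show ?thesis .
qed

section \<open>Vanishing integer combinations of roots of unity\<close>

text \<open>The powers of \<open>z\<close> sum to zero, and this is the only relation up to scaling:
  an irreducible polynomial of degree \<open>p - 1\<close> vanishes at \<open>z - 1\<close>, so no
  nonzero integer polynomial of smaller degree vanishes there.\<close>

lemma sum_prime_root_of_unity_eq_0_iff:
  fixes a :: "nat \<Rightarrow> int" and z :: complex
  assumes p: "Factorial_Ring.prime p" and z: "z ^ p = 1" "z \<noteq> 1"
  shows "(\<Sum>i<p. of_int (a i) * z ^ i) = 0 \<longleftrightarrow> (\<forall>i<p. a i = a 0)"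
proof
  have geom: "(\<Sum>i<p. z ^ i) = 0"
    using z by (simp add: sum_gp_strict)
  have p1: "p > 1" using p by (rule prime_gt_1_nat)
  then obtain n where n: "p = Suc n" "n > 0" by (cases p) auto
  {
    assume const: "\<forall>i<p. a i = a 0"
    have "(\<Sum>i<p. of_int (a i) * z ^ i) = of_int (a 0) * (\<Sum>i<p. z ^ i)"
      unfolding sum_distrib_left
    proof (rule sum.cong[OF refl])
      fix i assume "i \<in> {..<p}"
      then have "a i = a 0" using const by blast
      then show "of_int (a i) * z ^ i = of_int (a 0) * z ^ i" by (rule arg_cong)
    qed
    with geom show "(\<Sum>i<p. of_int (a i) * z ^ i) = 0" by simp
  }
  assume sum0: "(\<Sum>i<p. of_int (a i) * z ^ i) = 0"
  \<comment> \<open>\<open>f = ((1 + X) ^ p - 1) / X\<close>, the \<open>p\<close>-th cyclotomic polynomial shifted by 1\<close>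
  define f where "f = (\<Sum>i<p. Polynomial.monom (int (p choose Suc i)) i)"
  have coeff_f: "Polynomial.coeff f i = int (p choose Suc i)" for i
    unfolding f_def by (cases "i < p") (simp_all add: coeff_sum)
  have "Polynomial.degree f \<le> n"
    by (rule degree_le) (auto simp: coeff_f n binomial_eq_0)
  moreover have "n \<le> Polynomial.degree f"
    by (rule le_degree) (simp add: coeff_f n)
  ultimately have deg_f: "Polynomial.degree f = n" by simp
  have irred: "Factorial_Ring.irreducible f"
  proof (rule eisenstein_irreducible)
    show "prime_elem (int p)" using p by simp
    show "int p dvd Polynomial.coeff f i" if "i < Polynomial.degree f" for i
    proof -
      have "p dvd p choose Suc i"
        using that p deg_f n by (intro dvd_choose_prime) auto
      then show ?thesis by (simp only: coeff_f of_nat_dvd_iff)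
    qed
    show "lead_coeff f = 1" by (simp add: deg_f coeff_f n)
    have "\<not> p * p dvd p" using p1 by (auto dest: dvd_imp_le)
    then show "\<not> (int p)\<^sup>2 dvd Polynomial.coeff f 0"
      by (simp add: coeff_f power2_eq_square flip: of_nat_mult)
    show "Polynomial.degree f > 0" by (simp add: deg_f n)
  qed
  have "(z - 1) * ipoly f (z - 1) = (\<Sum>i<p. of_nat (p choose Suc i) * (z - 1) ^ Suc i)"
    by (simp add: f_def ipoly_sum_monom sum_distrib_left mult_ac)
  \<comment> \<open>The added 1 is the term \<open>i = 0\<close> of the binomial expansion of
    \<open>z ^ p\<close>. Since \<open>z ^ p = 1\<close>, the rest is zero, and \<open>z - 1\<close>
    can be cancelled.\<close>
  also have "1 + \<dots> = (\<Sum>i\<le>p. of_nat (p choose i) * (z - 1) ^ i)"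
    by (simp add: sum.atMost_shift)
  also have "\<dots> = ((z - 1) + 1) ^ p"
    by (subst binomial_ring) simp
  finally have f0: "ipoly f (z - 1) = 0" using z by simp
  \<comment> \<open>Subtracting \<open>a n\<close> times the geometric sum keeps the value at
    \<open>z\<close> and kills the top coefficient, so \<open>g\<close> has degree below
    \<open>n = p - 1\<close>.\<close>
  define b where "b i = a i - a n" for i
  define g where "g = (\<Sum>i<n. Polynomial.monom (b i) i)"
  have "ipoly g z = (\<Sum>i<p. of_int (b i) * z ^ i)"
    by (simp add: g_def ipoly_sum_monom n b_def)
  also have "\<dots> = (\<Sum>i<p. of_int (a i) * z ^ i) - of_int (a n) * (\<Sum>i<p. z ^ i)"
    by (simp add: b_def sum_subtractf sum_distrib_left algebra_simps)
  finally have "ipoly (pcompose g [:1, 1:]) (z - 1) = 0"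
    using sum0 geom by (simp add: ipoly_pcompose map_poly_pCons)
  moreover have "Polynomial.degree g < n"
    unfolding g_def using n by (intro degree_sum_less) (auto intro: le_less_trans[OF degree_monom_le])
  ultimately have "pcompose g [:1, 1:] = 0"
    using degree_le_of_common_root[OF irred f0, of "pcompose g [:1, 1:]"] deg_f
    by (force simp: degree_pcompose)
  then have "g = 0" by (simp add: pcompose_eq_0_iff)
  have "a i = a n" if "i < p" for i
  proof (cases "i < n")
    case True
    then have "b i = Polynomial.coeff g i" by (simp add: g_def coeff_sum)
    with \<open>g = 0\<close> show ?thesis by (simp add: b_def)
  next
    case False
    with that n show ?thesis by (simp add: not_less less_Suc_eq)
  qed
  then show "\<forall>i<p. a i = a 0" using p1 by (metis less_imp_le_nat less_trans zero_less_one)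
qed

section \<open>A character of a group of prime order\<close>

text \<open>Any \<open>g\<close> other than the identity generates the group, and \<chi> sends each
  power of \<open>g\<close> to the same power of a primitive root of unity. The last property
  carries the relations among roots of unity over to \<chi>; it also makes \<chi>
  nontrivial.\<close>

lemma (in group) prime_order_character:
  assumes p: "Factorial_Ring.prime (Coset.order G)"
  obtains \<chi> :: "'a \<Rightarrow> complex"
  where "\<chi> \<one> = 1"
    and "\<And>x y. x \<in> carrier G \<Longrightarrow> y \<in> carrier G \<Longrightarrow> \<chi> (x \<otimes> y) = \<chi> x * \<chi> y"
    and "\<And>x. x \<in> carrier G \<Longrightarrow> \<chi> (inv x) = cnj (\<chi> x)"
    and "\<And>a :: 'a \<Rightarrow> int. (\<Sum>x\<in>carrier G. of_int (a x) * \<chi> x) = 0 \<longleftrightarrow> (\<exists>c. \<forall>x\<in>carrier G. a x = c)"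
proof -
  define p where "p = Coset.order G"
  note p = p[folded p_def]
  have p1: "p > 1" using p by (rule prime_gt_1_nat)
  have fin: "finite (carrier G)" using p1 order_gt_0_iff_finite by (simp add: p_def)
  have "\<not> carrier G \<subseteq> {\<one>}"
    using p1 card_mono[of "{\<one>}" "carrier G"] by (auto simp: p_def Coset.order_def)
  then obtain g where g: "g \<in> carrier G" "g \<noteq> \<one>" by auto
  have "ord g dvd p" unfolding p_def using g(1) by (rule ord_dvd_group_order)
  moreover have "ord g \<noteq> 1" using g ord_eq_1 by simp
  ultimately have ord_g: "ord g = p" using p by (auto simp: prime_nat_iff)
  have pow_eq: "g [^] i = g [^] j \<longleftrightarrow> i mod p = j mod p" for i j :: nat
    using int_pow_eq[OF g(1), of "int i" "int j"]
    mod_eq_dvd_iff[of "int j" "int p" "int i"]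
    by (auto simp: int_pow_int ord_g simp flip: of_nat_mod)
  have inj: "inj_on (\<lambda>i::nat. g [^] i) {..<p}"
    by (auto simp: inj_on_def pow_eq)
  have bij: "bij_betw (\<lambda>i::nat. g [^] i) {..<p} (carrier G)"
    unfolding bij_betw_def
  proof (intro conjI inj card_subset_eq fin)
    show "card ((\<lambda>i::nat. g [^] i) ` {..<p}) = card (carrier G)"
      using card_image[OF inj] by (simp add: p_def Coset.order_def)
  qed (use g in auto)
  define z where "z = cis (2 * pi / p)"
  have zp: "z ^ p = 1" using p1 by (simp add: z_def DeMoivre)
  have z1: "z \<noteq> 1"
    using bij_betw_roots_unity[of p] p1
    by (auto simp: z_def bij_betw_def dest: inj_onD[where x = 1 and y = 0])
  have z_cong: "z ^ i = z ^ j" if "i mod p = j mod p" for i j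
  proof -
    have "z ^ i = z ^ (i mod p)" for i
      by (metis zp mult_div_mod_eq power_add power_mult power_one mult_1)
    with that show ?thesis by metis
  qed
  \<comment> \<open>\<open>inv_into\<close> serves as discrete logarithm to base \<open>g\<close>.
    Any other exponent gives the same value, as exponents matter only modulo
    \<open>p\<close>.\<close>
  define \<chi> where "\<chi> x = z ^ inv_into {..<p} (\<lambda>i::nat. g [^] i) x" for x
  have \<chi>: "\<chi> (g [^] i) = z ^ i" for i :: nat
    unfolding \<chi>_def
    by (rule z_cong, subst pow_eq[symmetric], rule f_inv_into_f)
       (use bij g in \<open>auto simp: bij_betw_def\<close>)
  have ex: "\<exists>i::nat. x = g [^] i" if "x \<in> carrier G" for x
    using bij that by (auto simp: bij_betw_def)
  have mult: "\<chi> (x \<otimes> y) = \<chi> x * \<chi> y" if "x \<in> carrier G" "y \<in> carrier G" for x y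
    using ex[OF that(1)] ex[OF that(2)] g by (auto simp: \<chi> nat_pow_mult power_add)
  have one: "\<chi> \<one> = 1"
    using \<chi>[of 0] by simp
  show ?thesis
  proof (rule that[OF one mult])
    fix x assume x: "x \<in> carrier G"
    have "\<chi> (inv x) * \<chi> x = 1"
      using mult[of "inv x" x] x one by simp
    moreover have "cnj (\<chi> x) * \<chi> x = 1"
      by (simp add: \<chi>_def z_def cis_cnj cis_mult flip: power_mult_distrib)
    ultimately show "\<chi> (inv x) = cnj (\<chi> x)"
      by (metis mult_cancel_right zero_neq_one mult_zero_right)
  next
    fix a :: "'a \<Rightarrow> int"
    have "(\<Sum>x\<in>carrier G. of_int (a x) * \<chi> x) = (\<Sum>i<p. of_int (a (g [^] i)) * z ^ i)"
      by (subst sum.reindex_bij_betw[OF bij, symmetric]) (simp add: \<chi>)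
    also have "\<dots> = 0 \<longleftrightarrow> (\<forall>i<p. a (g [^] i) = a (g [^] (0::nat)))"
      by (rule sum_prime_root_of_unity_eq_0_iff[OF p zp z1])
    also have "\<dots> \<longleftrightarrow> (\<exists>c. \<forall>x\<in>carrier G. a x = c)"
    proof
      assume "\<forall>i<p. a (g [^] i) = a (g [^] (0::nat))"
      then have "\<forall>x\<in>carrier G. a x = a (g [^] (0::nat))"
        unfolding bij_betw_imp_surj_on[OF bij, symmetric] by blast
      then show "\<exists>c. \<forall>x\<in>carrier G. a x = c" by blast
    next
      assume "\<exists>c. \<forall>x\<in>carrier G. a x = c"
      then obtain c where "\<forall>x\<in>carrier G. a x = c" by blast
      then show "\<forall>i<p. a (g [^] i) = a (g [^] (0::nat))"
        using g(1) by (simp del: nat_pow_0)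
    qed
    finally show "(\<Sum>x\<in>carrier G. of_int (a x) * \<chi> x) = 0 \<longleftrightarrow> (\<exists>c. \<forall>x\<in>carrier G. a x = c)" .
  qed
qed

section \<open>Character values of the defining equation\<close>

text \<open>Extended linearly, \<chi> is multiplicative on the group algebra and sends the right
  side of the SEDF equation to \<open>- lam\<close>. Adding the omitted term \<open>l = j\<close>,
  which is the squared norm of \<chi> on \<open>D j\<close>, completes the sum over all
  \<open>l\<close>.\<close>

lemma SEDF_character_sum:
  fixes G (structure) and \<chi> :: "'a \<Rightarrow> complex"
  assumes SEDF: "SEDF v m k lam G D"
    and one: "\<chi> \<one> = 1"
    and mult: "\<And>x y. x \<in> carrier G \<Longrightarrow> y \<in> carrier G \<Longrightarrow> \<chi> (x \<otimes> y) = \<chi> x * \<chi> y"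
    and inv: "\<And>x. x \<in> carrier G \<Longrightarrow> \<chi> (inv x) = cnj (\<chi> x)"
    and sum_0: "(\<Sum>x\<in>carrier G. \<chi> x) = 0"
    and j: "j \<in> {1..m}"
  shows "(\<Sum>x\<in>D j. \<chi> x) * cnj (\<Sum>l\<in>{1..m}. \<Sum>x\<in>D l. \<chi> x) =
    of_real ((norm (\<Sum>x\<in>D j. \<chi> x))\<^sup>2 - real lam)"
proof -
  have comm: "comm_group G" and fin: "finite (carrier G)"
    and D: "\<And>l. l \<in> {1..m} \<Longrightarrow> D l \<subseteq> carrier G"
    using SEDF by (auto simp: SEDF_def)
  interpret comm_group G by fact
  interpret A: cring "group_algebra G" by (rule cring_group_algebra[OF comm fin])
  define F where "F f = (\<Sum>x\<in>carrier G. f x * \<chi> x)" for f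
  define \<eta> where "\<eta> l = (\<Sum>x\<in>D l. \<chi> x)" for l
  have F_ind: "F (indicator S) = (\<Sum>x\<in>S. \<chi> x)" if "S \<subseteq> carrier G" for S
    unfolding F_def using that fin
    by (intro sum.mono_neutral_cong_right) (auto simp: indicator_def)
  have F_mult: "F (f \<otimes>\<^bsub>group_algebra G\<^esub> h) = F f * F h" for f h
  proof -
    have "F (f \<otimes>\<^bsub>group_algebra G\<^esub> h)
        = (\<Sum>x\<in>carrier G. \<Sum>y\<in>carrier G. f y * h (inv y \<otimes> x) * \<chi> x)"
      by (simp add: F_def group_algebra_mult_eq[OF is_group fin] sum_distrib_right)
    also have "\<dots> = (\<Sum>y\<in>carrier G. \<Sum>x\<in>carrier G. f y * h (inv y \<otimes> x) * \<chi> x)"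
      by (rule sum.swap)
    also have "\<dots> = (\<Sum>y\<in>carrier G. \<Sum>w\<in>carrier G. f y * \<chi> y * (h w * \<chi> w))"
    proof (rule sum.cong[OF refl])
      fix y assume y: "y \<in> carrier G"
      show "(\<Sum>x\<in>carrier G. f y * h (inv y \<otimes> x) * \<chi> x)
          = (\<Sum>w\<in>carrier G. f y * \<chi> y * (h w * \<chi> w))"
        \<comment> \<open>For fixed \<open>y\<close>, the substitution \<open>x = y w\<close>
          separates the convolution into a product.\<close>
        by (rule sum.reindex_bij_witness[where i = "\<lambda>w. y \<otimes> w" and j = "\<lambda>x. inv y \<otimes> x"])
          (use y in \<open>auto simp: m_assoc[symmetric] simp flip: mult\<close>)
    qed
    finally show ?thesis by (simp add: F_def sum_product)
  qed
  have F_sub: "F (subset_sum G (D l)) = \<eta> l"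
    and F_inv: "F (subset_inv_sum G (D l)) = cnj (\<eta> l)" if "l \<in> {1..m}" for l
  proof -
    note Dl = D[OF that]
    show "F (subset_sum G (D l)) = \<eta> l"
      by (simp add: subset_sum_eq_indicator[OF comm fin Dl] F_ind[OF Dl] \<eta>_def)
    have "inj_on (m_inv G) (D l)"
      by (rule inj_on_inverseI[where g = "m_inv G"]) (use Dl in auto)
    then have "F (subset_inv_sum G (D l)) = (\<Sum>x\<in>D l. \<chi> (inv x))"
      using Dl by (subst subset_inv_sum_eq_indicator[OF comm fin Dl], subst F_ind)
        (auto simp: sum.reindex)
    also have "\<dots> = cnj (\<eta> l)"
      using Dl inv by (auto simp: \<eta>_def intro!: sum.cong)
    finally show "F (subset_inv_sum G (D l)) = cnj (\<eta> l)" .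
  qed
  have carr: "subset_sum G S \<in> carrier (group_algebra G)"
    "subset_inv_sum G S \<in> carrier (group_algebra G)" if "S \<subseteq> carrier G" for S
    using that by (auto simp: subset_sum_eq_indicator[OF comm fin]
        subset_inv_sum_eq_indicator[OF comm fin] group_algebra_def indicator_def)
  have "F (\<Oplus>\<^bsub>group_algebra G\<^esub> l \<in> {1..m} - {j}.
         subset_sum G (D j) \<otimes>\<^bsub>group_algebra G\<^esub> subset_inv_sum G (D l))
      = (\<Sum>l\<in>{1..m} - {j}. F (subset_sum G (D j) \<otimes>\<^bsub>group_algebra G\<^esub> subset_inv_sum G (D l)))"
    (is "F ?L = _")
    using D j carr
    by (subst finsum_group_algebra[OF comm fin])
      (auto simp: F_def sum_distrib_right intro: sum.swap)
  also have "\<dots> = \<eta> j * cnj (\<Sum>l\<in>{1..m} - {j}. \<eta> l)"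
    using j by (simp add: F_mult F_sub F_inv sum_distrib_left)
  also have "?L = of_nat lam \<odot>\<^bsub>group_algebra G\<^esub>
      (subset_sum G (carrier G) \<ominus>\<^bsub>group_algebra G\<^esub> \<one>\<^bsub>group_algebra G\<^esub>)"
    using SEDF j by (simp add: SEDF_def)
  \<comment> \<open>Ring negation is specified only as an additive inverse, so its pointwise form
    comes from uniqueness of inverses.\<close>
  also have "\<ominus>\<^bsub>group_algebra G\<^esub> \<one>\<^bsub>group_algebra G\<^esub> = (\<lambda>x. - indicator {\<one>} x)"
    by (rule A.minus_equality) (auto simp: group_algebra_def indicator_def)
  then have "of_nat lam \<odot>\<^bsub>group_algebra G\<^esub>
      (subset_sum G (carrier G) \<ominus>\<^bsub>group_algebra G\<^esub> \<one>\<^bsub>group_algebra G\<^esub>)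
      = (\<lambda>x. of_nat lam * (indicator (carrier G) x - indicator {\<one>} x))"
    unfolding a_minus_def
    by (simp add: subset_sum_eq_indicator[OF comm fin]) (simp add: group_algebra_def)
  also have "F \<dots> = of_nat lam * (F (indicator (carrier G)) - F (indicator {\<one>}))"
    by (simp add: F_def sum_distrib_left sum_subtractf algebra_simps)
  also have "\<dots> = - of_nat lam"
    using sum_0 one by (simp add: F_ind)
  finally have "\<eta> j * cnj (\<Sum>l\<in>{1..m} - {j}. \<eta> l) = - of_nat lam" ..
  moreover have "(\<Sum>l\<in>{1..m}. \<eta> l) = \<eta> j + (\<Sum>l\<in>{1..m} - {j}. \<eta> l)"
    using j by (simp add: sum.remove)
  ultimately have "\<eta> j * cnj (\<Sum>l\<in>{1..m}. \<eta> l) = \<eta> j * cnj (\<eta> j) - of_nat lam"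
    by (simp add: algebra_simps)
  also have "\<dots> = of_real ((norm (\<eta> j))\<^sup>2 - real lam)"
    by (simp add: complex_norm_square flip: of_real_power)
  finally show ?thesis by (simp only: \<eta>_def)
qed

section \<open>Nonexistence for prime order\<close>

theorem theorem3p9:
  fixes v m k lam :: nat
  assumes "v > 0" and "m > 0" and "k > 0" and "lam > 0"
    and "k\<^sup>2 * (m - 1) = lam * (v - 1)"
    and "Factorial_Ring.prime v" and "k > 1" and "m > 2"
  shows "\<not> (\<exists>(G :: ('a, 'b) monoid_scheme) D. SEDF v m k lam G D)"
proof
  assume "\<exists>(G :: ('a, 'b) monoid_scheme) D. SEDF v m k lam G D"
  then obtain G :: "('a, 'b) monoid_scheme" and D where SEDF: "SEDF v m k lam G D" by blast
  have comm: "comm_group G" and fin: "finite (carrier G)" and v: "Coset.order G = v"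
    and D: "\<And>l. l \<in> {1..m} \<Longrightarrow> D l \<subseteq> carrier G" "\<And>l. l \<in> {1..m} \<Longrightarrow> card (D l) = k"
    and disj: "disjoint_family_on D {1..m}"
    using SEDF by (auto simp: SEDF_def)
  interpret comm_group G by fact
  have "Factorial_Ring.prime (Coset.order G)" using assms v by simp
  then obtain \<chi> :: "'a \<Rightarrow> complex" where one: "\<chi> \<one>\<^bsub>G\<^esub> = 1"
    and mult: "\<And>x y. x \<in> carrier G \<Longrightarrow> y \<in> carrier G \<Longrightarrow> \<chi> (x \<otimes>\<^bsub>G\<^esub> y) = \<chi> x * \<chi> y"
    and inv: "\<And>x. x \<in> carrier G \<Longrightarrow> \<chi> (inv\<^bsub>G\<^esub> x) = cnj (\<chi> x)"
    and indep: "\<And>a :: 'a \<Rightarrow> int. (\<Sum>x\<in>carrier G. of_int (a x) * \<chi> x) = 0 \<longleftrightarrow>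
      (\<exists>c. \<forall>x\<in>carrier G. a x = c)"
    by (rule prime_order_character) blast
  have sum_0: "(\<Sum>x\<in>carrier G. \<chi> x) = 0"
    using indep[of "\<lambda>_. 1"] by simp
  have sum_ind: "(\<Sum>x\<in>S. \<chi> x) = (\<Sum>x\<in>carrier G. of_int (indicator S x) * \<chi> x)"
    if "S \<subseteq> carrier G" for S
    using that fin by (intro sum.mono_neutral_cong_left) (auto simp: indicator_def)
  define \<eta> where "\<eta> l = (\<Sum>x\<in>D l. \<chi> x)" for l
  define s where "s = (\<Sum>l\<in>{1..m}. \<eta> l)"
  define r where "r l = (norm (\<eta> l))\<^sup>2 - real lam" for l
  have \<eta>: "\<eta> l * cnj s = of_real (r l)" if "l \<in> {1..m}" for l
    using SEDF_character_sum[OF SEDF one mult inv sum_0 that] by (simp add: \<eta>_def s_def r_def)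
  have finD: "finite (D l)" if "l \<in> {1..m}" for l
    using D(1)[OF that] fin finite_subset by blast
  have D_ne: "\<exists>x. x \<in> D l" if "l \<in> {1..m}" for l
    using D(2)[OF that] assms by (metis card.empty ex_in_conv less_irrefl)
  have eta_inj: "i = l" if i: "i \<in> {1..m}" and l: "l \<in> {1..m}" and eq: "\<eta> i = \<eta> l" for i l
  proof (rule ccontr)
    assume "i \<noteq> l"
    with disj i l have dis: "D i \<inter> D l = {}" by (auto simp: disjoint_family_on_def)
    \<comment> \<open>The coefficients would have to be constant, yet they are 1 on
      \<open>D i\<close> and -1 on \<open>D l\<close>.\<close>
    have "(\<Sum>x\<in>carrier G. of_int (indicator (D i) x - indicator (D l) x) * \<chi> x) = 0"
      using eq D i l by (simp add: \<eta>_def sum_ind left_diff_distrib sum_subtractf)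
    then obtain c :: int where c: "\<forall>x\<in>carrier G. indicator (D i) x - indicator (D l) x = c"
      unfolding indep by blast
    from D_ne i l obtain x y where xy: "x \<in> D i" "y \<in> D l" by blast
    then have "x \<notin> D l" "y \<notin> D i" using dis by auto
    with xy have "indicator (D i) x - indicator (D l) x = (1 :: int)"
      and "indicator (D i) y - indicator (D l) y = (- 1 :: int)" by simp_all
    moreover have "x \<in> carrier G" "y \<in> carrier G" using xy D i l by auto
    ultimately show False using c by force
  qed
  show False
  proof (cases "s = 0")
    case True
    define U where "U = (\<Union>l\<in>{1..m}. D l)"
    have U: "U \<subseteq> carrier G" using D(1) unfolding U_def by blast
    have "(\<Sum>x\<in>U. \<chi> x) = s"
      unfolding U_def s_def \<eta>_def using disj finD
      by (intro sum.UNION_disjoint) (auto simp: disjoint_family_on_def)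
    then obtain c :: int where c: "\<forall>x\<in>carrier G. indicator U x = c"
      using True indep[of "indicator U"] sum_ind[OF U] by auto
    have m: "1 \<in> {1..m}" using assms(2) by simp
    then obtain x where "x \<in> D 1" using D_ne by blast
    with m have x: "x \<in> U" unfolding U_def by blast
    \<comment> \<open>The indicator of \<open>U\<close> is constant on the group and equals 1 at
      \<open>x\<close>.\<close>
    have "U = carrier G"
    proof
      show "carrier G \<subseteq> U"
      proof
        fix y assume "y \<in> carrier G"
        moreover have "x \<in> carrier G" using x U by blast
        ultimately have "(indicator U y :: int) = indicator U x" using c by simp
        then show "y \<in> U" using x by (simp add: indicator_def split: if_splits)
      qed
    qed (rule U)
    moreover have "card U = (\<Sum>l\<in>{1..m}. card (D l))"
      unfolding U_def using disj finD
      by (intro card_UN_disjoint) (auto simp: disjoint_family_on_def)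
    ultimately have "v = m * k"
      using v D(2) by (simp add: Coset.order_def)
    then have "m dvd v" by simp
    \<comment> \<open>The first case contradicts \<open>m > 2\<close>; the second gives
      \<open>k = 1\<close>.\<close>
    then have "m = 1 \<or> m = v" using assms(6) by (simp add: prime_nat_iff)
    then show False using \<open>v = m * k\<close> assms(1,7,8) by auto
  next
    case False
    \<comment> \<open>Take norms in \<eta> and square; by definition of \<open>r\<close>, the
      squared norm of \<open>\<eta> l\<close> is \<open>r l + real lam\<close>.\<close>
    have quad: "(r l)\<^sup>2 = (norm s)\<^sup>2 * (r l + real lam)" if "l \<in> {1..m}" for l
    proof -
      have "norm (\<eta> l) * norm s = \<bar>r l\<bar>"
        using arg_cong[OF \<eta>[OF that], of norm] by (simp add: norm_mult)
      then have "(r l)\<^sup>2 = (norm (\<eta> l) * norm s)\<^sup>2" by simp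
      then show ?thesis by (simp add: r_def power_mult_distrib)
    qed
    have r_inj: "i = l" if "i \<in> {1..m}" "l \<in> {1..m}" "r i = r l" for i l
    proof -
      have "\<eta> i * cnj s = \<eta> l * cnj s"
        using \<eta>[OF that(1)] \<eta>[OF that(2)] that(3) by simp
      then have "\<eta> i = \<eta> l" using False by simp
      with that show ?thesis by (intro eta_inj)
    qed
    \<comment> \<open>Distinct \<open>r i\<close> and \<open>r l\<close> are the two roots of one quadratic, so their sum is determined.\<close>
    have vieta: "r i + r l = (norm s)\<^sup>2" if "i \<in> {1..m}" "l \<in> {1..m}" "i \<noteq> l" for i l
    proof -
      have "(r i - r l) * (r i + r l) = (r i - r l) * (norm s)\<^sup>2"
        using quad[OF that(1)] quad[OF that(2)] by (simp add: algebra_simps power2_eq_square)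
      moreover have "r i \<noteq> r l" using r_inj that by blast
      ultimately show ?thesis by simp
    qed
    \<comment> \<open>Both are the partner of \<open>r 1\<close> among the two roots;
      \<open>m > 2\<close> supplies the third index.\<close>
    have "r 2 = r 3" using vieta[of 1 2] vieta[of 1 3] assms by simp
    then show False using r_inj[of 2 3] assms by simp
  qed
qed

end
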